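(* Let $\mathcal{H}$ be a real Hilbert space, let $n\in\mathbb{N}\smallsetminus\{0\}$ and $m=2n-1$. Let $U_1,\ldots,U_n$ be closed linear subspaces of $\mathcal{H}$ with $U_1^\perp+\cdots+U_n^\perp$ closed, and set $U_{n+i}:=U_{n-i}$ for every $i\in\{1,\ldots,n-1\}$. Let $\mathcal{S}$ be a finite set of operators with $\Psi\subseteq\mathcal{S}\subseteq\Omega$, where $$\Omega=\{\mathrm{R}_{U_{i_r}}\cdots\mathrm{R}_{U_{i_2}}\mathrm{R}_{U_{i_1}} : r\in\mathbb{N},\ i_1,\ldots,i_r\in\{1,\ldots,m\}\},$$ $$\Psi=\{\mathrm{R}_{U_{i_r}}\cdots\mathrm{R}_{U_{i_2}}\mathrm{R}_{U_{i_1}} : r\in\{0,1,\ldots,m\},\ i_1,\ldots,i_r\in\{1,\ldots,m\},\ i_1<\cdots<i_r\}.$$ Set $T:=\mathrm{P}_{U_m}\cdots\mathrm{P}_{U_1}=\mathrm{P}_{U_1}\cdots\mathrm{P}_{U_{n-1}}\mathrm{P}_{U_n}\mathrm{P}_{U_{n-1}}\cdots\mathrm{P}_{U_1}$, $c(T):=\|T\mathrm{P}_{(\operatorname{Fix}T)^\perp}\|$, $\gamma:=\|\mathrm{P}_{U_n}\mathrm{P}_{U_{n-1}}\cdots\mathrm{P}_{U_1}\mathrm{P}_{(\cap_{i=1}^mU_i)^\perp}\|$, $$c_1:=\inf\{\langle Tx,x\rangle : x\in(\operatorname{Fix}T)^\perp,\|x\|=1\},\qquad c_2:=\sup\{\langle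 Tx,x\rangle : x\in(\operatorname{Fix}T)^\perp,\|x\|=1\},$$ where $c_1:=c_2:=0$ if $(\operatorname{Fix}T)^\perp=\{0\}$, and $\eta:=\frac{c_2-c_1}{2-c_1-c_2}$. Then for every $k\in\mathbb{N}$, $\eta^kc(T)\le\gamma^{2(k+1)}$, and for every $x\in\mathcal{H}$ and every $k\in\mathbb{N}$, $$\|CC_{\mathcal{S}}^k(Tx)-\mathrm{P}_{\cap_{i=1}^nU_i}x\|\le\eta^k\,c(T)\,\|x-\mathrm{P}_{\cap_{i=1}^nU_i}x\|.$$
   Context: $\mathbb{N}=\{0,1,2,\ldots\}$, and $\eta^0=1$ also for $\eta=0$. $\operatorname{Fix}T=\{x:Tx=x\}$. $\mathrm{P}_C$ is the projector (best approximation operator) onto $C$, and $\mathrm{R}_C=2\mathrm{P}_C-\mathrm{Id}$ is the reflector associated with $C$. The empty composition ($r=0$) is $\mathrm{Id}$. $C^\perp$ is the orthogonal complement; $\|\cdot\|$ of a bounded linear operator is the operator norm. Circumcenter mapping: for a finite set $\mathcal{S}$ of isometries of $\mathcal{H}$ having a common fixed point (such as a finite subset of $\Omega$), and $x\in\mathcal{H}$, let $\mathcal{S}(x)=\{Gx: G\in\mathcal{S}\}$. It is known that there is a unique point $CC_{\mathcal{S}}(x)$ that lies in the affine hull $\operatorname{aff}(\mathcal{S}(x))$ and is equidistant from all points of $\mathcal{S}(x)$; this defines the circumcenter mapping $CC_{\mathcal{S}}:\mathcal{H}\to\mathcal{H}$. $CC_{\mathcal{S}}^k$ is its $k$-fold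 composition. *)

theory Defs
  imports "HOL-Analysis.Analysis"
begin

text \<open>
  Real Hilbert spaces are rendered by the sort \<open>{real_inner, complete_space}\<close>.
  The library's \<open>closest_point\<close> is restricted to Heine-Borel, i.e. finite-dimensional,
  spaces, hence the following version. It is the best approximation operator whenever \<open>C\<close>
  has a unique nearest point to each \<open>x\<close>, in particular for closed linear subspaces.
\<close>

definition proj :: "'a::real_inner set \<Rightarrow> 'a \<Rightarrow> 'a" where
  "proj C x = (THE y. y \<in> C \<and> (\<forall>z\<in>C. dist x y \<le> dist x z))"

definition reflector :: "'a::real_inner set \<Rightarrow> 'a \<Rightarrow> 'a" where
  "reflector C x = 2 *\<^sub>R proj C x - x"

definition Fix :: "('a \<Rightarrow> 'a) \<Rightarrow> 'a set" where
  "Fix T = {x. T x = x}"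

text \<open>
  A finite sequence of indices is a list \<open>[i\<^sub>1, \<dots>, i\<^sub>r]\<close>, and
  \<open>fold F [i\<^sub>1, \<dots>, i\<^sub>r] = F i\<^sub>r \<circ> \<dots> \<circ> F i\<^sub>1\<close>; the first index of the list is
  applied first, and the empty list gives the identity.
\<close>

definition proj_comp :: "(nat \<Rightarrow> 'a::real_inner set) \<Rightarrow> nat list \<Rightarrow> 'a \<Rightarrow> 'a" where
  "proj_comp U is = fold (\<lambda>i. proj (U i)) is"

definition refl_comp :: "(nat \<Rightarrow> 'a::real_inner set) \<Rightarrow> nat list \<Rightarrow> 'a \<Rightarrow> 'a" where
  "refl_comp U is = fold (\<lambda>i. reflector (U i)) is"

definition Omega :: "(nat \<Rightarrow> 'a::real_inner set) \<Rightarrow> nat \<Rightarrow> ('a \<Rightarrow> 'a) set" where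
  "Omega U m = {refl_comp U is | is. set is \<subseteq> {1..m}}"

definition Psi :: "(nat \<Rightarrow> 'a::real_inner set) \<Rightarrow> nat \<Rightarrow> ('a \<Rightarrow> 'a) set" where
  "Psi U m = {refl_comp U is | is. length is \<le> m \<and> set is \<subseteq> {1..m} \<and> sorted_wrt (<) is}"

text \<open>
  The description is used only for finite nonempty sets \<open>S\<close> of isometries with a common fixed
  point, where the point described exists and is unique.
\<close>

definition CC :: "('a::real_inner \<Rightarrow> 'a) set \<Rightarrow> 'a \<Rightarrow> 'a" where
  "CC S x = (THE p. p \<in> affine hull ((\<lambda>G. G x) ` S) \<and>
                    (\<forall>y\<in>(\<lambda>G. G x) ` S. \<forall>z\<in>(\<lambda>G. G x) ` S. dist p y = dist p z))"

definition c_lower :: "('a::real_inner \<Rightarrow> 'a) \<Rightarrow> real" where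
  "c_lower T = (if (Fix T)\<^sup>\<bottom> = {0} then 0
                else Inf {inner (T x) x | x. x \<in> (Fix T)\<^sup>\<bottom> \<and> norm x = 1})"

definition c_upper :: "('a::real_inner \<Rightarrow> 'a) \<Rightarrow> real" where
  "c_upper T = (if (Fix T)\<^sup>\<bottom> = {0} then 0
                else Sup {inner (T x) x | x. x \<in> (Fix T)\<^sup>\<bottom> \<and> norm x = 1})"

text \<open>
  With the convention \<open>U (n + i) = U (n - i)\<close>, the composition of the projectors with indices
  \<open>1, \<dots>, 2 n - 1\<close> is the symmetric one with indices \<open>1, \<dots>, n, n - 1, \<dots>, 1\<close>.
\<close>

lemma proj_comp_symmetric:
  assumes "n \<ge> 1" and U: "\<And>i. i \<in> {1..n - 1} \<Longrightarrow> U (n + i) = U (n - i)"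
  shows "proj_comp U [1..<Suc (2 * n - 1)] = proj_comp U ([1..<Suc n] @ rev [1..<n])"
proof -
  have upt: "[1..<Suc (2 * n - 1)] = [1..<Suc n] @ [Suc n..<2 * n]"
    using assms(1) upt_add_eq_append[of 1 "Suc n" "n - 1"] by (simp add: mult_2)
  have "map U [Suc n..<2 * n] = map U (rev [1..<n])"
  proof (rule nth_equalityI)
    fix j assume "j < length (map U [Suc n..<2 * n])"
    then have j: "j < n - 1" by simp
    then have "Suc (n - Suc (Suc j)) = n - Suc j" by arith
    with j show "map U [Suc n..<2 * n] ! j = map U (rev [1..<n]) ! j"
      using U[of "Suc j"] by (simp add: rev_nth)
  qed simp
  moreover have "fold (\<lambda>i. proj (U i)) is = fold proj (map U is)" for "is"
    by (simp add: fold_map comp_def)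
  ultimately show ?thesis
    unfolding proj_comp_def upt by (simp only: fold_append map_append)
qed

end

theory Submission
  imports Defs
begin

text \<open>
  Write \<open>M = U\<^sub>1 \<inter> \<dots> \<inter> U\<^sub>n\<close> and \<open>A = P\<^sub>n \<dots> P\<^sub>1\<close>. The palindromic composition
  is \<open>T = A\<^sup>* A\<close>, so it is positive semidefinite; as it fixes \<open>M\<close>, it maps \<open>M\<^sup>\<bottom>\<close> into itself. A
  projector shortens every vector that it moves, so \<open>Fix T = M\<close>.

  Every operator in \<open>S\<close> is a composition of reflectors, hence preserves the distance to each point
  \<open>z\<close> of \<open>M\<close>. Thus \<open>z\<close> is equidistant from all \<open>G x\<close>, and by Pythagoras so is its projection onto
  the affine hull of these points: the circumcenter is the point of that hull nearest to \<open>z\<close>, for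
  every \<open>z \<in> M\<close> at once (\<open>circumcenter_nearest\<close>). Taking \<open>z = P\<^sub>M x\<close>, \<open>CC S\<close>
  approaches \<open>P\<^sub>M x\<close> at least as well as any map \<open>F\<close> whose values \<open>F x\<close> lie in the affine hulls of the sets \<open>S(x)\<close> (\<open>norm_CC_funpow_le\<close>).
  Since \<open>P\<^sub>i = (Id + R\<^sub>i) / 2\<close>, expanding the product writes \<open>T\<close> as an affine combination of \<open>\<Psi>\<close>
  (\<open>proj_comp_in_affine_hull_Psi\<close>), so every relaxation \<open>(1 - \<alpha>) Id + \<alpha> T\<close> is such a map. On
  \<open>M\<^sup>\<bottom>\<close> it is self-adjoint with numerical range between \<open>1 - \<alpha> (1 - c\<^sub>1)\<close> and \<open>1 - \<alpha> (1 - c\<^sub>2)\<close>, and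
  the choice \<open>\<alpha> = 2 / (2 - c\<^sub>1 - c\<^sub>2)\<close> makes these bounds \<open>-\<eta>\<close> and \<open>\<eta>\<close>. So its norm there is at
  most \<open>\<eta>\<close> (\<open>relaxation_norm_le\<close>). Starting from \<open>T x\<close> contributes the factor \<open>c(T)\<close>.

  For the comparison with \<open>\<gamma>\<close>, the factorization \<open>T = A\<^sup>* A\<close> gives \<open>c(T) \<le> \<gamma>\<^sup>2\<close> and
  \<open>c\<^sub>2 \<le> \<gamma>\<^sup>2\<close>, and \<open>0 \<le> c\<^sub>1 \<le> c\<^sub>2 \<le> 1\<close> gives \<open>\<eta> \<le> c\<^sub>2\<close>. The denominator of \<open>\<eta>\<close> is positive
  because \<open>c\<^sub>1 = 1\<close> would make \<open>A\<close> isometric on \<open>M\<^sup>\<bottom>\<close>, that is, \<open>M\<^sup>\<bottom> \<subseteq> M\<close>.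
\<close>

section \<open>Orthogonal projectors in Hilbert spaces\<close>

lemma dist_le_of_orthogonal:
  fixes x y z :: "'a::real_inner"
  assumes "inner (x - y) (z - y) = 0"
  shows "norm (y - x) \<le> norm (z - x)"
proof -
  have "(norm (z - x))\<^sup>2 = (norm (y - x))\<^sup>2 + (norm (z - y))\<^sup>2"
    using assms by (simp add: power2_norm_eq_inner inner_diff inner_commute algebra_simps)
  then show ?thesis
    by (simp add: power2_le_imp_le)
qed

text \<open>
  The parallelogram law, applied to \<open>x - u\<close> and \<open>x - v\<close>, whose half sum is the distance vector to
  a point of \<open>V\<close> again. This makes minimizing sequences Cauchy.
\<close>

lemma quasi_minimizers_close:
  fixes x u v :: "'a::real_inner"
  assumes V: "subspace V" "u \<in> V" "v \<in> V"
    and d: "\<And>z. z \<in> V \<Longrightarrow> d \<le> (norm (x - z))\<^sup>2"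
    and u: "(norm (x - u))\<^sup>2 < d + e" and v: "(norm (x - v))\<^sup>2 < d + e"
  shows "(norm (u - v))\<^sup>2 < 4 * e"
proof -
  have "(1/2) *\<^sub>R (u + v) \<in> V"
    using V by (simp add: subspace_add subspace_scale)
  from d[OF this] have "d \<le> (norm (x - (1/2) *\<^sub>R (u + v)))\<^sup>2" .
  moreover have "(norm (u - v))\<^sup>2 + 4 * (norm (x - (1/2) *\<^sub>R (u + v)))\<^sup>2
      = 2 * (norm (x - u))\<^sup>2 + 2 * (norm (x - v))\<^sup>2"
    by (simp add: power2_norm_eq_inner inner_diff inner_add inner_commute algebra_simps)
  ultimately show ?thesis using u v by linarith
qed

lemma minimizer_orthogonal:
  fixes x y z :: "'a::real_inner"
  assumes V: "subspace V" "y \<in> V" "z \<in> V"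
    and min: "\<And>w. w \<in> V \<Longrightarrow> norm (x - y) \<le> norm (x - w)"
  shows "inner (x - y) z = 0"
proof (cases "z = 0")
  case False
  \<comment> \<open>This \<open>t\<close> minimizes the distance from \<open>x\<close> to the line through \<open>y\<close> with direction \<open>z\<close>.\<close>
  define t where "t = inner (x - y) z / inner z z"
  have zz: "inner z z > 0" using False by simp
  have "y + t *\<^sub>R z \<in> V" using V by (simp add: subspace_add subspace_scale)
  then have "(norm (x - y))\<^sup>2 \<le> (norm (x - y - t *\<^sub>R z))\<^sup>2"
    using min[of "y + t *\<^sub>R z"] by (simp add: diff_diff_eq power_mono)
  also have "\<dots> = (norm (x - y))\<^sup>2 - 2 * t * inner (x - y) z + t * t * inner z z"
    by (simp add: power2_norm_eq_inner inner_diff_left inner_diff_right inner_commute algebra_simps)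
  also have "\<dots> = (norm (x - y))\<^sup>2 - (inner (x - y) z)\<^sup>2 / inner z z"
    using zz by (simp add: t_def power2_eq_square field_simps)
  finally have "(inner (x - y) z)\<^sup>2 / inner z z \<le> 0" by simp
  then have "(inner (x - y) z)\<^sup>2 \<le> 0" using zz by (simp add: divide_le_0_iff)
  then show ?thesis by simp
qed simp

lemma closed_subspace_decomposition:
  fixes V :: "'a::{real_inner, complete_space} set"
  assumes V: "subspace V" "closed V"
  shows "\<exists>y\<in>V. \<forall>z\<in>V. inner (x - y) z = 0"
proof -
  define D where "D = (\<lambda>z. (norm (x - z))\<^sup>2) ` V"
  define d where "d = Inf D"
  have ne: "D \<noteq> {}" using subspace_0[OF V(1)] by (auto simp: D_def)
  have bdd: "bdd_below D" by (auto simp: D_def intro!: bdd_belowI[of _ 0])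
  have dle: "d \<le> (norm (x - z))\<^sup>2" if "z \<in> V" for z
    unfolding d_def by (rule cInf_lower[OF _ bdd]) (use that in \<open>auto simp: D_def\<close>)
  have "\<exists>z. z \<in> V \<and> (norm (x - z))\<^sup>2 < d + inverse (real (Suc k))" for k
    using cInf_lessD[OF ne, of "d + inverse (real (Suc k))"] by (auto simp: D_def d_def)
  then obtain f where fV: "\<And>k. f k \<in> V"
    and f: "\<And>k. (norm (x - f k))\<^sup>2 < d + inverse (real (Suc k))" by metis
  have "Cauchy f"
  proof (rule CauchyI)
    fix e :: real assume e: "0 < e"
    then have "0 < e\<^sup>2 / 4" by simp
    from reals_Archimedean[OF this] obtain N where N: "inverse (real (Suc N)) < e\<^sup>2 / 4" ..
    have *: "(norm (x - f k))\<^sup>2 < d + e\<^sup>2 / 4" if "k \<ge> N" for k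
    proof -
      have "inverse (real (Suc k)) \<le> inverse (real (Suc N))" using that by simp
      with f[of k] N show ?thesis by linarith
    qed
    have "norm (f a - f b) < e" if "a \<ge> N" "b \<ge> N" for a b
      using quasi_minimizers_close[OF V(1) fV fV dle *[OF that(1)] *[OF that(2)]] e
      by (simp add: power_less_imp_less_base)
    then show "\<exists>M. \<forall>a\<ge>M. \<forall>b\<ge>M. norm (f a - f b) < e" by blast
  qed
  then obtain y where lim: "f \<longlonglongrightarrow> y" using Cauchy_convergent convergent_def by blast
  have yV: "y \<in> V" using V(2) fV lim closed_sequentially by blast
  have "(\<lambda>k. (norm (x - f k))\<^sup>2) \<longlonglongrightarrow> (norm (x - y))\<^sup>2"
    by (intro tendsto_intros lim)
  moreover have "(\<lambda>k. d + inverse (real (Suc k))) \<longlonglongrightarrow> d + 0"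
    by (intro tendsto_intros LIMSEQ_inverse_real_of_nat)
  ultimately have "(norm (x - y))\<^sup>2 \<le> d + 0"
    by (rule LIMSEQ_le) (use f less_imp_le in blast)
  then have yd: "(norm (x - y))\<^sup>2 \<le> d" by simp
  have "norm (x - y) \<le> norm (x - w)" if "w \<in> V" for w
    using order.trans[OF yd dle[OF that]] by (rule power2_le_imp_le[OF _ norm_ge_zero])
  then have "inner (x - y) z = 0" if "z \<in> V" for z
    using minimizer_orthogonal[OF V(1) yV that] by blast
  with yV show ?thesis by blast
qed

lemma proj_unique:
  assumes V: "subspace V" "y \<in> V" and orth: "\<And>z. z \<in> V \<Longrightarrow> inner (x - y) z = 0"
  shows "proj V x = y"
  unfolding proj_def
proof (rule the_equality)
  show "y \<in> V \<and> (\<forall>z\<in>V. dist x y \<le> dist x z)"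
    using V orth by (auto simp: dist_norm norm_minus_commute[of x] subspace_diff
        intro!: dist_le_of_orthogonal)
next
  fix w assume w: "w \<in> V \<and> (\<forall>z\<in>V. dist x w \<le> dist x z)"
  then have "inner (x - w) (w - y) = 0"
    using V by (intro minimizer_orthogonal[of V]) (auto simp: dist_norm subspace_diff)
  moreover have "inner (x - y) (w - y) = 0" using w V by (simp add: orth subspace_diff)
  ultimately have "inner (w - y) (w - y) = 0"
    by (simp add: inner_diff_left)
  then show "w = y" by simp
qed

context
  fixes V :: "'a::{real_inner, complete_space} set"
  assumes V: "subspace V" "closed V"
begin

lemma proj_in: "proj V x \<in> V"
  and proj_orthogonal: "z \<in> V \<Longrightarrow> inner (x - proj V x) z = 0"
proof -
  obtain y where "y \<in> V" "\<And>z. z \<in> V \<Longrightarrow> inner (x - y) z = 0"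
    using closed_subspace_decomposition[OF V] by blast
  moreover from this have "proj V x = y" by (rule proj_unique[OF V(1)])
  ultimately show "proj V x \<in> V" "z \<in> V \<Longrightarrow> inner (x - proj V x) z = 0" by simp_all
qed

lemma inner_proj_left: "inner (proj V x) y = inner (proj V x) (proj V y)"
  using proj_orthogonal[OF proj_in, of y x] by (simp add: inner_diff_left inner_diff_right inner_commute)

lemma proj_self_adjoint: "inner (proj V x) y = inner x (proj V y)"
  using inner_proj_left[of x y] inner_proj_left[of y x] by (simp add: inner_commute)

lemma proj_pythagoras: "(norm x)\<^sup>2 = (norm (proj V x))\<^sup>2 + (norm (x - proj V x))\<^sup>2"
  using inner_proj_left[of x x]
  by (simp add: power2_norm_eq_inner inner_diff inner_commute)

lemma norm_proj_le: "norm (proj V x) \<le> norm x"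
  by (rule power2_le_imp_le) (use proj_pythagoras[of x] in auto)

lemma in_of_norm_proj_eq: "norm (proj V x) = norm x \<Longrightarrow> x \<in> V"
  using proj_pythagoras[of x] proj_in[of x] by simp

lemma proj_id: "x \<in> V \<Longrightarrow> proj V x = x"
  by (rule proj_unique) (auto simp: V)

lemma bounded_linear_proj: "bounded_linear (proj V)"
proof (rule bounded_linear_intro[where K=1])
  show "proj V (x + y) = proj V x + proj V y" for x y
  proof (rule proj_unique[OF V(1)])
    show "inner (x + y - (proj V x + proj V y)) z = 0" if "z \<in> V" for z
      using proj_orthogonal[OF that, of x] proj_orthogonal[OF that, of y]
      by (simp add: inner_diff_left inner_add_left)
  qed (intro subspace_add V(1) proj_in)
  show "proj V (r *\<^sub>R x) = r *\<^sub>R proj V x" for r x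
  proof (rule proj_unique[OF V(1)])
    show "inner (r *\<^sub>R x - r *\<^sub>R proj V x) z = 0" if "z \<in> V" for z
      using proj_orthogonal[OF that, of x] by (simp add: inner_diff_left)
  qed (intro subspace_scale V(1) proj_in)
qed (simp add: norm_proj_le)

lemma diff_proj_in_orthogonal_comp: "x - proj V x \<in> V\<^sup>\<bottom>"
  using proj_orthogonal by (fastforce simp: orthogonal_comp_def orthogonal_def inner_commute)

lemma proj_orthogonal_comp: "proj (V\<^sup>\<bottom>) x = x - proj V x"
  by (rule proj_unique)
     (use subspace_orthogonal_comp diff_proj_in_orthogonal_comp proj_in in
       \<open>auto simp: orthogonal_comp_def orthogonal_def\<close>)

lemma norm_reflector_diff:
  assumes "z \<in> V" shows "norm (reflector V x - z) = norm (x - z)"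
proof -
  have "inner (x - proj V x) (proj V x - z) = 0"
    using proj_in assms V by (intro proj_orthogonal) (simp add: subspace_diff)
  then have "(norm (reflector V x - z))\<^sup>2 = (norm (x - z))\<^sup>2"
    unfolding reflector_def power2_norm_eq_inner
    by (simp add: inner_diff inner_commute algebra_simps)
  then show ?thesis by simp
qed

lemma bounded_linear_reflector: "bounded_linear (reflector V)"
  unfolding reflector_def[abs_def]
  by (intro bounded_linear_sub bounded_linear_ident
      bounded_linear_compose[OF bounded_linear_scaleR_right bounded_linear_proj])

end

section \<open>Circumcenters\<close>

text \<open>
  The Gram-Schmidt process: \<open>c\<close> is the projection of the new vector \<open>b\<close> onto the old
  span, and the approximation of \<open>x\<close> is corrected along \<open>b - c\<close>.
\<close>

lemma finite_span_decomposition: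
  fixes B :: "'a::real_inner set"
  assumes "finite B"
  shows "\<exists>y\<in>span B. \<forall>z\<in>span B. inner (x - y) z = 0"
  using assms
proof (induction B arbitrary: x)
  case empty
  then show ?case by simp
next
  case (insert b B)
  obtain y where y: "y \<in> span B" "\<And>z. z \<in> span B \<Longrightarrow> inner (x - y) z = 0"
    using insert.IH by blast
  obtain c where c: "c \<in> span B" "\<And>z. z \<in> span B \<Longrightarrow> inner (b - c) z = 0"
    using insert.IH by blast
  define t where "t = inner (x - y) (b - c) / inner (b - c) (b - c)"
  define w where "w = y + t *\<^sub>R (b - c)"
  have sub: "span B \<subseteq> span (insert b B)" by (intro span_mono) auto
  then have bc: "b - c \<in> span (insert b B)"
    using c(1) by (intro span_diff) (auto intro: span_base)
  have orth: "inner (x - w) z = 0" if "z \<in> span B" for z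
    using y(2)[OF that] c(2)[OF that] by (simp add: w_def inner_diff_left inner_add_left)
  have orth': "inner (x - w) (b - c) = 0"
  proof (cases "b = c")
    case False
    then have "t * inner (b - c) (b - c) = inner (x - y) (b - c)" by (simp add: t_def)
    then show ?thesis by (simp add: w_def diff_diff_eq[symmetric] inner_diff_left[of "x - y"])
  qed simp
  have "inner (x - w) z = 0" if "z \<in> span (insert b B)" for z
  proof -
    obtain k where "z - k *\<^sub>R b \<in> span B" using \<open>z \<in> _\<close> by (auto simp: span_insert)
    then have "z - k *\<^sub>R b + k *\<^sub>R c \<in> span B" using c(1) by (intro span_add span_scale)
    from orth[OF this] orth' show ?thesis
      by (simp add: inner_diff_right inner_add_right)
  qed
  moreover have "w \<in> span (insert b B)"
    unfolding w_def using y(1) sub bc by (intro span_add span_scale) auto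
  ultimately show ?case by blast
qed

lemma finite_affine_hull_decomposition:
  fixes Y :: "'a::real_inner set"
  assumes "finite Y" "Y \<noteq> {}"
  obtains p where "p \<in> affine hull Y" "\<And>y. y \<in> affine hull Y \<Longrightarrow> inner (z - p) (y - p) = 0"
proof -
  obtain a where a: "a \<in> Y" using assms by blast
  define B where "B = (\<lambda>y. y - a) ` (Y - {a})"
  have "B = {y - a | y. y \<in> Y - {a}}" by (auto simp: B_def)
  then have hull: "affine hull Y = {a + v | v. v \<in> span B}"
    using affine_hull_span[OF a] by simp
  obtain u where u: "u \<in> span B" "\<And>v. v \<in> span B \<Longrightarrow> inner (z - a - u) v = 0"
    using finite_span_decomposition[of B "z - a"] assms by (auto simp: B_def)
  show ?thesis
  proof (rule that[of "a + u"])
    show "inner (z - (a + u)) (y - (a + u)) = 0" if "y \<in> affine hull Y" for y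
      using that u by (auto simp: hull diff_diff_eq span_diff)
  qed (use u in \<open>auto simp: hull\<close>)
qed

lemma equidistant_orthogonal:
  fixes p q :: "'a::real_inner"
  assumes "dist p y = dist p a" "dist q y = dist q a"
  shows "inner (q - p) y = inner (q - p) a"
proof -
  have "(norm (p - y))\<^sup>2 = (norm (p - a))\<^sup>2" "(norm (q - y))\<^sup>2 = (norm (q - a))\<^sup>2"
    using assms by (simp_all add: dist_norm)
  then show ?thesis
    by (simp add: power2_norm_eq_inner inner_diff_left inner_diff_right inner_commute)
qed

text \<open>
  The projection \<open>p\<close> of \<open>z\<close> onto the affine hull is equidistant from all \<open>G x\<close> by Pythagoras. If
  \<open>q\<close> is another such point of the hull, then \<open>q - p\<close> is orthogonal to all differences of points
  of the hull, in particular to itself.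
\<close>

lemma circumcenter_nearest:
  fixes S :: "('a::real_inner \<Rightarrow> 'a) set"
  assumes S: "finite S" "S \<noteq> {}"
    and z: "\<And>G. G \<in> S \<Longrightarrow> norm (G x - z) = r"
  shows "CC S x \<in> affine hull ((\<lambda>G. G x) ` S)"
    and "y \<in> affine hull ((\<lambda>G. G x) ` S) \<Longrightarrow> norm (CC S x - z) \<le> norm (y - z)"
proof -
  define Y where "Y = (\<lambda>G. G x) ` S"
  have Y: "finite Y" "Y \<noteq> {}" using S by (auto simp: Y_def)
  obtain p where p: "p \<in> affine hull Y"
    and orth: "\<And>y. y \<in> affine hull Y \<Longrightarrow> inner (z - p) (y - p) = 0"
    using finite_affine_hull_decomposition[OF Y] by blast
  have r: "(norm (y - p))\<^sup>2 = r\<^sup>2 - (norm (z - p))\<^sup>2" if "y \<in> Y" for y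
  proof -
    have "norm (y - z) = r" using that z by (auto simp: Y_def)
    then have "r\<^sup>2 = (norm (y - p - (z - p)))\<^sup>2" by simp
    also have "\<dots> = (norm (y - p))\<^sup>2 + (norm (z - p))\<^sup>2"
      using orth[OF hull_inc[OF that]]
      unfolding power2_norm_eq_inner inner_diff_left[of "y - p"] inner_diff_right[of _ "y - p" "z - p"]
      by (simp add: inner_commute)
    finally show ?thesis by simp
  qed
  have eq: "dist p y = dist p y'" if "y \<in> Y" "y' \<in> Y" for y y'
  proof -
    have "(norm (y - p))\<^sup>2 = (norm (y' - p))\<^sup>2" using r that by simp
    then show ?thesis by (simp add: dist_norm norm_minus_commute)
  qed
  have unique: "q = p"
    if q: "q \<in> affine hull Y" and qeq: "\<And>y y'. y \<in> Y \<Longrightarrow> y' \<in> Y \<Longrightarrow> dist q y = dist q y'" for q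
  proof -
    obtain a where a: "a \<in> Y" using Y by blast
    have "affine hull Y \<subseteq> {y. inner (q - p) y = inner (q - p) a}"
      using equidistant_orthogonal[OF eq[OF _ a] qeq[OF _ a]]
      by (intro hull_minimal affine_hyperplane) auto
    then have "inner (q - p) y = inner (q - p) a" if "y \<in> affine hull Y" for y
      using that by blast
    from this[OF q] this[OF p] have "inner (q - p) q = inner (q - p) p" by simp
    then have "inner (q - p) (q - p) = 0" by (simp add: inner_diff_right)
    then show ?thesis by simp
  qed
  have CC: "CC S x = p"
    unfolding CC_def Y_def[symmetric]
    by (rule the_equality) (use p eq unique in blast)+
  show "CC S x \<in> affine hull ((\<lambda>G. G x) ` S)"
    using p by (simp add: CC Y_def)
  show "norm (CC S x - z) \<le> norm (y - z)" if "y \<in> affine hull ((\<lambda>G. G x) ` S)"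
    unfolding CC using orth[of y] that
    by (intro dist_le_of_orthogonal) (simp add: Y_def)
qed

section \<open>Compositions of projectors and reflectors\<close>

context
  fixes U :: "nat \<Rightarrow> 'a::{real_inner, complete_space} set" and I :: "nat set"
  assumes U: "\<And>i. i \<in> I \<Longrightarrow> subspace (U i) \<and> closed (U i)"
begin

lemma bounded_linear_proj_comp:
  "set is \<subseteq> I \<Longrightarrow> bounded_linear (proj_comp U is)"
proof (induction "is" rule: rev_induct)
  case Nil
  then show ?case by (simp add: proj_comp_def id_def bounded_linear_ident)
next
  case (snoc i "is")
  then have "bounded_linear (\<lambda>x. proj (U i) (proj_comp U is x))"
    using U by (intro bounded_linear_compose[OF bounded_linear_proj]) auto
  then show ?case by (simp add: proj_comp_def comp_def)
qed

lemma proj_comp_adjoint: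
  "set is \<subseteq> I \<Longrightarrow> inner (proj_comp U (rev is) x) y = inner x (proj_comp U is y)"
  using U by (induction "is" arbitrary: x y) (auto simp: proj_comp_def proj_self_adjoint)

lemma norm_proj_comp_le: "set is \<subseteq> I \<Longrightarrow> norm (proj_comp U is x) \<le> norm x"
proof (induction "is" arbitrary: x)
  case (Cons i "is")
  then have "norm (proj_comp U is (proj (U i) x)) \<le> norm (proj (U i) x)" by simp
  also have "\<dots> \<le> norm x" using Cons.prems U by (intro norm_proj_le) auto
  finally show ?case by (simp add: proj_comp_def)
qed (simp add: proj_comp_def)

lemma proj_comp_id:
  "set is \<subseteq> I \<Longrightarrow> x \<in> (\<Inter>i\<in>set is. U i) \<Longrightarrow> proj_comp U is x = x"
  using U by (induction "is") (auto simp: proj_comp_def proj_id)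

text \<open>
  No projector increases norms, so if the composition preserves the norm of \<open>x\<close>, then so does the
  first projector. By Pythagoras it fixes \<open>x\<close>, and the next one acts on \<open>x\<close> again.
\<close>

lemma in_Inter_of_norm_proj_comp_eq:
  assumes "set is \<subseteq> I" "norm (proj_comp U is x) = norm x"
  shows "x \<in> (\<Inter>i\<in>set is. U i)"
  using assms
proof (induction "is")
  case (Cons i "is")
  then have Ui: "subspace (U i)" "closed (U i)" using U by auto
  have eq: "proj_comp U (i # is) x = proj_comp U is (proj (U i) x)" by (simp add: proj_comp_def)
  have "norm x \<le> norm (proj (U i) x)"
    using norm_proj_comp_le[of "is" "proj (U i) x"] Cons.prems by (simp add: eq)
  then have "x \<in> U i"
    using norm_proj_le[OF Ui, of x] by (intro in_of_norm_proj_eq[OF Ui]) simp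
  moreover from this have "norm (proj_comp U is x) = norm x"
    using Cons.prems by (simp add: eq proj_id[OF Ui])
  ultimately show ?case using Cons by simp
qed simp

lemma norm_refl_comp_diff:
  "set is \<subseteq> I \<Longrightarrow> z \<in> (\<Inter>i\<in>set is. U i) \<Longrightarrow> norm (refl_comp U is x - z) = norm (x - z)"
  using U by (induction "is" arbitrary: x) (auto simp: refl_comp_def norm_reflector_diff)

end

text \<open>
  The last projector averages the identity and its reflector. Composing an increasing word over
  \<open>{1..k}\<close> with either of them yields an increasing word over \<open>{1..Suc k}\<close>.
\<close>

lemma proj_comp_in_affine_hull_Psi:
  fixes U :: "nat \<Rightarrow> 'a::{real_inner, complete_space} set"
  assumes "\<And>i. i \<in> {1..k} \<Longrightarrow> subspace (U i) \<and> closed (U i)"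
  shows "proj_comp U [1..<Suc k] x \<in> affine hull ((\<lambda>G. G x) ` Psi U k)"
  using assms
proof (induction k)
  case 0
  have "id \<in> Psi U 0" by (auto simp: Psi_def refl_comp_def)
  then show ?case 
    by (intro hull_inc image_eqI[of _ _ id]) (simp_all add: proj_comp_def)
next
  case (Suc k)
  define y where "y = proj_comp U [1..<Suc k] x"
  define A where "A = (\<lambda>G. G x) ` Psi U k"
  define B where "B = (\<lambda>G. G x) ` Psi U (Suc k)"
  let ?R = "reflector (U (Suc k))"
  have R: "bounded_linear ?R" using Suc.prems by (intro bounded_linear_reflector) auto
  have y: "y \<in> affine hull A" using Suc by (simp add: y_def A_def)
  have "Psi U k \<subseteq> Psi U (Suc k)" by (fastforce simp: Psi_def)
  then have AB: "A \<subseteq> B" by (auto simp: A_def B_def)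
  have RAB: "?R ` A \<subseteq> B"
  proof
    fix w assume "w \<in> ?R ` A"
    then obtain js where js: "length js \<le> k" "set js \<subseteq> {1..k}" "sorted_wrt (<) js"
      and w: "w = ?R (refl_comp U js x)" by (auto simp: A_def Psi_def)
    have "refl_comp U (js @ [Suc k]) \<in> Psi U (Suc k)"
      using js unfolding Psi_def by (fastforce simp: sorted_wrt_append)
    moreover have "w = refl_comp U (js @ [Suc k]) x" by (simp add: w refl_comp_def)
    ultimately show "w \<in> B" by (auto simp: B_def)
  qed
  have "?R y \<in> affine hull (?R ` A)"
    using y affine_hull_linear_image[OF R, of A] by blast
  then have "?R y \<in> affine hull B" using hull_mono[OF RAB] by blast
  moreover have "y \<in> affine hull B" using y hull_mono[OF AB] by blast
  ultimately have "(1/2) *\<^sub>R y + (1/2) *\<^sub>R ?R y \<in> affine hull B"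
    by (intro mem_affine affine_affine_hull) auto
  moreover have "(1/2) *\<^sub>R y + (1/2) *\<^sub>R ?R y = proj (U (Suc k)) y"
    by (simp add: reflector_def scaleR_diff_right)
  moreover have "proj (U (Suc k)) y = proj_comp U [1..<Suc (Suc k)] x"
    by (simp add: proj_comp_def y_def)
  ultimately show ?case by (simp add: B_def)
qed

section \<open>Numerical range of a self-adjoint operator\<close>

text \<open>
  The norm of a self-adjoint operator is bounded by its numerical radius: polarization bounds
  \<open>inner (F x) y\<close>, and \<open>y\<close> is the multiple of \<open>F x\<close> with the norm of \<open>x\<close>.
\<close>

lemma self_adjoint_norm_le:
  fixes F :: "'a::real_inner \<Rightarrow> 'a"
  assumes V: "subspace V" and F: "linear F" "\<And>x. x \<in> V \<Longrightarrow> F x \<in> V"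
    and sa: "\<And>x y. inner (F x) y = inner x (F y)"
    and b: "\<And>x. x \<in> V \<Longrightarrow> \<bar>inner (F x) x\<bar> \<le> b * (norm x)\<^sup>2"
    and x: "x \<in> V"
  shows "norm (F x) \<le> b * norm x"
proof (cases "x = 0 \<or> F x = 0")
  case True
  have "0 \<le> b * norm x"
  proof (cases "x = 0")
    case False
    then have "0 < (norm x)\<^sup>2" by simp
    moreover have "0 \<le> b * (norm x)\<^sup>2" using b[OF x] by linarith
    ultimately have "0 \<le> b" by (simp add: zero_le_mult_iff)
    then show ?thesis by simp
  qed simp
  then show ?thesis using True linear_0[OF F(1)] by auto
next
  case False
  define y where "y = (norm x / norm (F x)) *\<^sub>R F x"
  have ny: "norm y = norm x" using False by (simp add: y_def)
  have yV: "y \<in> V" unfolding y_def by (intro subspace_scale V F x)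
  have "4 * inner (F x) y = inner (F (x + y)) (x + y) - inner (F (x - y)) (x - y)"
    using sa[of x y] by (simp add: linear_add[OF F(1)] linear_diff[OF F(1)] inner_add_left
        inner_add_right inner_diff_left inner_diff_right inner_commute)
  also have "\<dots> \<le> b * (norm (x + y))\<^sup>2 + b * (norm (x - y))\<^sup>2"
    using b[OF subspace_add[OF V x yV]] b[OF subspace_diff[OF V x yV]] by linarith
  also have "\<dots> = b * (2 * inner x x + 2 * inner y y)"
    unfolding power2_norm_eq_inner by (simp add: inner_add_left
        inner_add_right inner_diff_left inner_diff_right inner_commute algebra_simps)
  also have "\<dots> = 4 * (b * (norm x)\<^sup>2)"
    using ny by (simp add: dot_square_norm)
  finally have "inner (F x) y \<le> b * (norm x)\<^sup>2" by simp
  moreover have "inner (F x) y = norm x * norm (F x)"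
    using False by (simp add: y_def dot_square_norm power2_eq_square)
  ultimately have "norm x * norm (F x) \<le> norm x * (b * norm x)"
    by (simp add: power2_eq_square mult_ac)
  then show ?thesis using False by simp
qed

text \<open>
  The relaxation parameter centers the numerical range of the relaxed operator at zero, which
  minimizes the bound that the numerical radius gives.
\<close>

lemma relaxation_norm_le:
  fixes T :: "'a::real_inner \<Rightarrow> 'a"
  assumes V: "subspace V" and T: "linear T" "\<And>x. x \<in> V \<Longrightarrow> T x \<in> V"
    and sa: "\<And>x y. inner (T x) y = inner x (T y)"
    and lower: "\<And>x. x \<in> V \<Longrightarrow> c\<^sub>1 * (norm x)\<^sup>2 \<le> inner (T x) x"
    and upper: "\<And>x. x \<in> V \<Longrightarrow> inner (T x) x \<le> c\<^sub>2 * (norm x)\<^sup>2"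
    and c: "c\<^sub>1 + c\<^sub>2 < 2" and x: "x \<in> V"
  shows "norm (x + (2 / (2 - c\<^sub>1 - c\<^sub>2)) *\<^sub>R (T x - x)) \<le> (c\<^sub>2 - c\<^sub>1) / (2 - c\<^sub>1 - c\<^sub>2) * norm x"
proof -
  define d where "d = 2 - c\<^sub>1 - c\<^sub>2"
  define F where "F = (\<lambda>x. x + (2 / d) *\<^sub>R (T x - x))"
  have d: "d > 0" using c by (simp add: d_def)
  have "linear F"
    unfolding F_def
    by (intro linear_compose_add linear_compose_scale_right linear_compose_sub linear_ident T)
  moreover have "F x \<in> V" if "x \<in> V" for x
    unfolding F_def using that by (intro subspace_add subspace_scale subspace_diff V T)
  moreover have "inner (F x) y = inner x (F y)" for x y
    by (simp add: F_def inner_add_left inner_add_right inner_diff_left inner_diff_right sa)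
  moreover have "\<bar>inner (F x) x\<bar> \<le> (c\<^sub>2 - c\<^sub>1) / d * (norm x)\<^sup>2" if "x \<in> V" for x
  proof -
    define N where "N = (norm x)\<^sup>2"
    have "d * inner (F x) x = d * N + 2 * (inner (T x) x - N)"
      using d by (simp add: F_def N_def inner_add_left inner_diff_left power2_norm_eq_inner
          field_simps)
    moreover have "c\<^sub>1 * N \<le> inner (T x) x" "inner (T x) x \<le> c\<^sub>2 * N"
      using lower upper that by (simp_all add: N_def)
    ultimately have "\<bar>d * inner (F x) x\<bar> \<le> (c\<^sub>2 - c\<^sub>1) * N"
      by (simp add: d_def abs_le_iff algebra_simps)
    then have "d * \<bar>inner (F x) x\<bar> \<le> (c\<^sub>2 - c\<^sub>1) * N"
      using d by (simp add: abs_mult)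
    then show ?thesis using d by (simp add: N_def field_simps)
  qed
  ultimately have "norm (F x) \<le> (c\<^sub>2 - c\<^sub>1) / d * norm x"
    using self_adjoint_norm_le[OF V, of F] x by blast
  then show ?thesis by (simp add: F_def d_def)
qed

lemma c_lower_upper_bounds:
  fixes T :: "'a::real_inner \<Rightarrow> 'a"
  assumes T: "linear T" and b: "0 \<le> b"
    and q: "\<And>x. x \<in> (Fix T)\<^sup>\<bottom> \<Longrightarrow> 0 \<le> inner (T x) x"
      "\<And>x. x \<in> (Fix T)\<^sup>\<bottom> \<Longrightarrow> inner (T x) x \<le> b * (norm x)\<^sup>2"
  shows "0 \<le> c_lower T" "c_lower T \<le> c_upper T" "c_upper T \<le> b"
    and "x \<in> (Fix T)\<^sup>\<bottom> \<Longrightarrow> c_lower T * (norm x)\<^sup>2 \<le> inner (T x) x"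
    and "x \<in> (Fix T)\<^sup>\<bottom> \<Longrightarrow> inner (T x) x \<le> c_upper T * (norm x)\<^sup>2"
proof -
  let ?V = "(Fix T)\<^sup>\<bottom>"
  define Q where "Q = {inner (T x) x | x. x \<in> ?V \<and> norm x = 1}"
  have *: "0 \<le> c_lower T \<and> c_lower T \<le> c_upper T \<and> c_upper T \<le> b \<and>
    (\<forall>x\<in>?V. c_lower T * (norm x)\<^sup>2 \<le> inner (T x) x \<and> inner (T x) x \<le> c_upper T * (norm x)\<^sup>2)"
  proof (cases "?V = {0}")
    case True
    then show ?thesis using b by (simp add: c_lower_def c_upper_def)
  next
    case False
    then have c: "c_lower T = Inf Q" "c_upper T = Sup Q"
      by (simp_all add: c_lower_def c_upper_def Q_def)
    have unit: "inner (T x) x / (norm x)\<^sup>2 \<in> Q" if "x \<in> ?V" "x \<noteq> 0" for x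
    proof -
      have "(1 / norm x) *\<^sub>R x \<in> ?V" using that by (intro subspace_scale subspace_orthogonal_comp)
      moreover have "inner (T ((1 / norm x) *\<^sub>R x)) ((1 / norm x) *\<^sub>R x) = inner (T x) x / (norm x)\<^sup>2"
        by (simp add: linear_scale[OF T] power2_eq_square)
      moreover have "norm ((1 / norm x) *\<^sub>R x) = 1" using that by simp
      ultimately show ?thesis unfolding Q_def by (metis (mono_tags, lifting) mem_Collect_eq)
    qed
    have bounds: "0 \<le> t \<and> t \<le> b" if "t \<in> Q" for t
      using that q by (force simp: Q_def)
    have bdd: "bdd_below Q" "bdd_above Q" using bounds by (auto simp: bdd_below_def bdd_above_def)
    have le: "Inf Q \<le> t" "t \<le> Sup Q" if "t \<in> Q" for t
      using that bdd by (auto intro: cInf_lower cSup_upper)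
    obtain v where "v \<in> ?V" "v \<noteq> 0"
      using False subspace_0[OF subspace_orthogonal_comp, of "Fix T"] by blast
    then have "Q \<noteq> {}" using unit by blast
    then obtain t where "t \<in> Q" by blast
    have "0 \<le> Inf Q" using \<open>Q \<noteq> {}\<close> bounds by (intro cInf_greatest) auto
    moreover have "Sup Q \<le> b" using \<open>Q \<noteq> {}\<close> bounds by (intro cSup_least) auto
    moreover have "Inf Q \<le> Sup Q" using le[OF \<open>t \<in> Q\<close>] by linarith
    moreover have "Inf Q * (norm x)\<^sup>2 \<le> inner (T x) x \<and> inner (T x) x \<le> Sup Q * (norm x)\<^sup>2"
      if "x \<in> ?V" for x
    proof (cases "x = 0")
      case False
      then show ?thesis using le[OF unit[OF that False]] by (simp add: field_simps)
    qed simp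
    ultimately show ?thesis by (simp add: c)
  qed
  then show "0 \<le> c_lower T" "c_lower T \<le> c_upper T" "c_upper T \<le> b" by simp_all
  show "x \<in> ?V \<Longrightarrow> c_lower T * (norm x)\<^sup>2 \<le> inner (T x) x"
    "x \<in> ?V \<Longrightarrow> inner (T x) x \<le> c_upper T * (norm x)\<^sup>2" using * by simp_all
qed

section \<open>Contraction of the circumcenter mapping\<close>

context
  fixes S :: "('a::{real_inner, complete_space} \<Rightarrow> 'a) set" and M :: "'a set"
  assumes S: "finite S" "S \<noteq> {}" and M: "subspace M" "closed M"
    and iso: "\<And>G x z. G \<in> S \<Longrightarrow> z \<in> M \<Longrightarrow> norm (G x - z) = norm (x - z)"
begin

text \<open>
  Preserving the distances to \<open>0\<close> and to \<open>z\<close> amounts to preserving the inner product with \<open>z\<close>.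
  Hence all \<open>G x\<close> lie in the hyperplane of the points with the same inner product with \<open>z\<close> as \<open>x\<close>, and so
  does their affine hull.
\<close>

lemma proj_CC: "proj M (CC S x) = proj M x"
proof (rule proj_unique[OF M(1) proj_in[OF M]])
  fix z assume z: "z \<in> M"
  have "inner z (G x) = inner z x" if "G \<in> S" for G
  proof -
    have "(norm (G x - z))\<^sup>2 = (norm (x - z))\<^sup>2" "(norm (G x))\<^sup>2 = (norm x)\<^sup>2"
      using iso[OF that z, of x] iso[OF that subspace_0[OF M(1)], of x] by simp_all
    then show ?thesis
      by (simp add: power2_norm_eq_inner inner_diff_left inner_diff_right inner_commute)
  qed
  then have "affine hull ((\<lambda>G. G x) ` S) \<subseteq> {y. inner z y = inner z x}"
    by (intro hull_minimal affine_hyperplane) auto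
  moreover have "CC S x \<in> affine hull ((\<lambda>G. G x) ` S)"
    by (rule circumcenter_nearest(1)[OF S, of x z]) (rule iso[OF _ z])
  ultimately have "inner z (CC S x) = inner z x" by blast
  then show "inner (CC S x - proj M x) z = 0"
    using proj_orthogonal[OF M z, of x]
    by (simp add: inner_diff_left inner_diff_right inner_commute)
qed

text \<open>
  In each step the circumcenter of \<open>S(y)\<close> is at least as close to \<open>P\<^sub>M y\<close> as \<open>F y\<close>, and
  \<open>P\<^sub>M y\<close> is the same for all iterates.
\<close>

lemma norm_CC_funpow_le:
  assumes F: "\<And>x. F x \<in> affine hull ((\<lambda>G. G x) ` S)"
    and \<eta>: "0 \<le> \<eta>" "\<And>x. norm (F x - proj M x) \<le> \<eta> * norm (x - proj M x)"
  shows "norm ((CC S ^^ k) x - proj M x) \<le> \<eta> ^ k * norm (x - proj M x)"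
proof (induction k)
  case (Suc k)
  define y where "y = (CC S ^^ k) x"
  have y: "proj M y = proj M x" unfolding y_def by (induction k) (simp_all add: proj_CC)
  have "norm (CC S y - proj M y) \<le> norm (F y - proj M y)"
    using circumcenter_nearest(2)[OF S iso[OF _ proj_in[OF M], of _ y] F] .
  also have "\<dots> \<le> \<eta> * norm (y - proj M y)" by (rule \<eta>)
  also have "\<dots> \<le> \<eta> * (\<eta> ^ k * norm (x - proj M x))"
    using Suc.IH \<eta>(1) by (intro mult_left_mono) (simp_all add: y y_def[symmetric])
  finally show ?case using y by (simp add: y_def mult_ac)
qed simp

end

theorem theorem6p10:
  fixes U :: "nat \<Rightarrow> 'a::{real_inner, complete_space} set"
    and n m :: nat
    and S :: "('a \<Rightarrow> 'a) set"
    and T :: "'a \<Rightarrow> 'a"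
    and cT \<gamma> c\<^sub>1 c\<^sub>2 \<eta> :: real
  assumes "n \<noteq> 0" and "m = 2 * n - 1"
    and "\<And>i. i \<in> {1..n} \<Longrightarrow> subspace (U i) \<and> closed (U i)"
    and "closed (\<Sum>i\<in>{1..n}. (U i)\<^sup>\<bottom>)"
    and "\<And>i. i \<in> {1..n - 1} \<Longrightarrow> U (n + i) = U (n - i)"
    and "finite S" and "Psi U m \<subseteq> S" and "S \<subseteq> Omega U m"
    and "T = proj_comp U [1..<Suc m]"
    and "cT = onorm (T \<circ> proj ((Fix T)\<^sup>\<bottom>))"
    and "\<gamma> = onorm (proj_comp U [1..<Suc n] \<circ> proj ((\<Inter>i\<in>{1..m}. U i)\<^sup>\<bottom>))"
    and "c\<^sub>1 = c_lower T" and "c\<^sub>2 = c_upper T"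
    and "\<eta> = (c\<^sub>2 - c\<^sub>1) / (2 - c\<^sub>1 - c\<^sub>2)"
  shows "(\<forall>k::nat. \<eta> ^ k * cT \<le> \<gamma> ^ (2 * (k + 1))) \<and>
         (\<forall>x. \<forall>k::nat.
            norm ((CC S ^^ k) (T x) - proj (\<Inter>i\<in>{1..n}. U i) x)
              \<le> \<eta> ^ k * cT * norm (x - proj (\<Inter>i\<in>{1..n}. U i) x))"
proof -
  define M where "M = (\<Inter>i\<in>{1..n}. U i)"
  define V where "V = M\<^sup>\<bottom>"
  define A where "A = proj_comp U [1..<Suc n]"
  define B where "B = proj_comp U [1..<n]"
  note sym = assms(5)
  have mirror: "\<exists>j\<in>{1..n}. U i = U j" if i: "i \<in> {1..m}" for i
  proof (cases "i \<le> n")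
    case False
    with i assms(2) have "i - n \<in> {1..n - 1}" by auto
    from sym[OF this] False have "U i = U (n - (i - n))" by simp
    moreover have "n - (i - n) \<in> {1..n}" using False i assms(2) by auto
    ultimately show ?thesis by blast
  qed (use i in auto)
  have U: "subspace (U i) \<and> closed (U i)" if "i \<in> {1..m}" for i
    using mirror[OF that] assms(3) by auto
  have nm: "{1..n} \<subseteq> {1..m}" using assms(1,2) by auto
  have M_eq: "(\<Inter>i\<in>{1..m}. U i) = M"
    unfolding M_def using mirror nm by blast
  have M: "subspace M" "closed M"
    unfolding M_def using assms(3) by (auto intro!: subspace_Int closed_INT)
  have V: "subspace V" by (simp add: V_def subspace_orthogonal_comp)
  have sets: "set [1..<Suc m] = {1..m}" "set [1..<Suc n] = {1..n}" by auto

  have linA: "bounded_linear A"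
    unfolding A_def by (rule bounded_linear_proj_comp[where I = "{1..m}"]) (use U nm in auto)
  have linT: "bounded_linear T"
    unfolding assms(9) by (rule bounded_linear_proj_comp[where I = "{1..m}"]) (use U in auto)
  note T_linear = bounded_linear.linear[OF linT]
  have A_le: "norm (A x) \<le> norm x" for x
    unfolding A_def by (rule norm_proj_comp_le[where I = "{1..m}"]) (use U nm in auto)
  have A_eq: "A x = proj (U n) (B x)" for x
    using assms(1) by (simp add: A_def B_def proj_comp_def)
  have T_eq: "T x = proj_comp U (rev [1..<n]) (A x)" for x
  proof -
    have "T = proj_comp U ([1..<Suc n] @ rev [1..<n])"
      unfolding assms(9) assms(2) using assms(1) sym by (intro proj_comp_symmetric) auto
    then show ?thesis by (simp add: proj_comp_def A_def)
  qed
  \<comment> \<open>This is \<open>T = A\<^sup>* A\<close>: the reversed word \<open>1, \<dots>, n - 1\<close> gives \<open>B\<^sup>*\<close>, and \<open>P\<^sub>n\<close> may be inserted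
    on the right because \<open>A x\<close> lies in \<open>U\<^sub>n\<close>.\<close>
  have TA: "inner (T x) y = inner (A x) (A y)" for x y
  proof -
    have "inner (T x) y = inner (A x) (B y)"
      unfolding T_eq B_def by (rule proj_comp_adjoint[where I = "{1..m}"]) (use U nm in auto)
    also have "\<dots> = inner (A x) (A y)"
      unfolding A_eq using assms(1,3) by (intro inner_proj_left) auto
    finally show ?thesis .
  qed
  have sa: "inner (T x) y = inner x (T y)" for x y
    using TA[of x y] TA[of y x] by (simp add: inner_commute)
  have quad: "inner (T x) x = (norm (A x))\<^sup>2" for x
    by (simp add: TA power2_norm_eq_inner)
  have A_isometric: "x \<in> M" if "norm (A x) = norm x" for x
  proof -
    have "x \<in> (\<Inter>i\<in>set [1..<Suc n]. U i)"
      by (rule in_Inter_of_norm_proj_comp_eq[where I = "{1..m}"]) (use U nm that A_def in auto)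
    then show ?thesis by (simp only: M_def sets)
  qed
  have T_fixes: "T z = z" if "z \<in> M" for z
    unfolding assms(9)
  proof (rule proj_comp_id[where I = "{1..m}"])
    show "z \<in> (\<Inter>i\<in>set [1..<Suc m]. U i)" using that by (simp only: M_eq sets)
  qed (use U in auto)
  have Fix_T: "Fix T = M"
  proof
    show "Fix T \<subseteq> M"
    proof
      fix x assume "x \<in> Fix T"
      then have "(norm (A x))\<^sup>2 = (norm x)\<^sup>2"
        using quad[of x] by (simp add: Fix_def power2_norm_eq_inner)
      then show "x \<in> M" by (intro A_isometric) simp
    qed
  qed (use T_fixes in \<open>auto simp: Fix_def\<close>)
  have T_V: "T x \<in> V" if "x \<in> V" for x
    using that sa[symmetric] T_fixes
    by (auto simp: V_def orthogonal_comp_def orthogonal_def)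

  have proj_V: "proj V = (\<lambda>x. x - proj M x)"
    by (simp add: fun_eq_iff V_def proj_orthogonal_comp[OF M])
  have in_V: "x - proj M x \<in> V" for x
    by (simp add: V_def diff_proj_in_orthogonal_comp[OF M])
  have lin_proj_V: "bounded_linear (proj V)"
    unfolding proj_V by (intro bounded_linear_sub bounded_linear_ident bounded_linear_proj[OF M])
  have proj_V_id: "proj V x = x" if "x \<in> V" for x
    by (rule proj_unique[OF V that]) simp
  have proj_V_le: "norm (proj V x) \<le> norm x" for x
    by (rule power2_le_imp_le) (use proj_pythagoras[OF M, of x] in \<open>auto simp: proj_V\<close>)

  have cT: "cT = onorm (\<lambda>x. T (proj V x))"
    by (simp add: assms(10) Fix_T V_def comp_def)
  have \<gamma>: "\<gamma> = onorm (\<lambda>x. A (proj V x))"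
    unfolding assms(11) M_eq by (simp add: V_def A_def comp_def)
  have bl: "bounded_linear (\<lambda>x. A (proj V x))" "bounded_linear (\<lambda>x. T (proj V x))"
    using linA linT lin_proj_V by (auto intro: bounded_linear_compose)
  have \<gamma>0: "0 \<le> \<gamma>" and cT0: "0 \<le> cT" using bl by (simp_all add: \<gamma> cT onorm_pos_le)
  have A_\<gamma>: "norm (A x) \<le> \<gamma> * norm x" if "x \<in> V" for x
    using onorm[OF bl(1), of x] by (simp add: \<gamma> proj_V_id that)
  have T_\<gamma>: "norm (T x) \<le> \<gamma>\<^sup>2 * norm x" if x: "x \<in> V" for x
  proof (cases "T x = 0")
    case False
    \<comment> \<open>As \<open>T x\<close> is again in \<open>M\<^sup>\<bottom>\<close>, the bound on \<open>A\<close> applies to both factors.\<close>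
    have "norm (T x) * norm (T x) = inner (A x) (A (T x))"
      using TA[of x "T x"] by (simp add: dot_square_norm power2_eq_square)
    also have "\<dots> \<le> norm (A x) * norm (A (T x))" by (rule norm_cauchy_schwarz)
    also have "\<dots> \<le> (\<gamma> * norm x) * (\<gamma> * norm (T x))"
      using A_\<gamma> x T_V \<gamma>0 by (intro mult_mono) auto
    finally have "norm (T x) * norm (T x) \<le> (\<gamma>\<^sup>2 * norm x) * norm (T x)"
      by (simp add: power2_eq_square mult_ac)
    then show ?thesis using False by simp
  qed simp
  have cT_le: "cT \<le> \<gamma>\<^sup>2"
    unfolding cT
  proof (rule onorm_bound)
    fix x
    have "proj V x \<in> V" by (simp add: proj_V in_V)
    then have "norm (T (proj V x)) \<le> \<gamma>\<^sup>2 * norm (proj V x)" by (rule T_\<gamma>)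
    also have "\<dots> \<le> \<gamma>\<^sup>2 * norm x" by (intro mult_left_mono proj_V_le) simp
    finally show "norm (T (proj V x)) \<le> \<gamma>\<^sup>2 * norm x" .
  qed simp

  have quad_\<gamma>: "inner (T x) x \<le> \<gamma>\<^sup>2 * (norm x)\<^sup>2" if "x \<in> (Fix T)\<^sup>\<bottom>" for x
    using power_mono[OF A_\<gamma>, of x 2] that by (simp add: quad Fix_T V_def power_mult_distrib)
  have quad_1: "inner (T x) x \<le> 1 * (norm x)\<^sup>2" for x
    using power_mono[OF A_le, of x 2] by (simp add: quad)
  note c_bounds = c_lower_upper_bounds[OF T_linear, folded assms(12,13)]
  have c: "0 \<le> c\<^sub>1" "c\<^sub>1 \<le> c\<^sub>2" "c\<^sub>2 \<le> 1" "c\<^sub>2 \<le> \<gamma>\<^sup>2"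
    using c_bounds(1-3)[of 1] c_bounds(3)[of "\<gamma>\<^sup>2"] quad_\<gamma> quad_1 by (simp_all add: quad)
  have lower: "c\<^sub>1 * (norm x)\<^sup>2 \<le> inner (T x) x" and upper: "inner (T x) x \<le> c\<^sub>2 * (norm x)\<^sup>2"
    if "x \<in> V" for x
    using c_bounds(4,5)[of 1 x] quad_1 that by (simp_all add: quad Fix_T V_def)
  have "c\<^sub>1 < 1"
  proof (rule ccontr)
    assume "\<not> c\<^sub>1 < 1"
    have "x = 0" if x: "x \<in> V" for x
    proof -
      have "1 * (norm x)\<^sup>2 \<le> c\<^sub>1 * (norm x)\<^sup>2"
        using \<open>\<not> c\<^sub>1 < 1\<close> by (intro mult_right_mono) auto
      then have "(norm x)\<^sup>2 \<le> (norm (A x))\<^sup>2" using lower[OF x] unfolding quad by linarith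
      then have "norm x \<le> norm (A x)" by (rule power2_le_imp_le) simp
      then have "x \<in> M" using A_le[of x] by (intro A_isometric) simp
      then show "x = 0" using x by (auto simp: V_def orthogonal_comp_def orthogonal_def)
    qed
    then have "V = {0}" using subspace_0[OF V] by auto
    then have "c\<^sub>1 = 0" by (simp add: assms(12) c_lower_def Fix_T V_def)
    then show False using \<open>\<not> c\<^sub>1 < 1\<close> by simp
  qed
  with c have d: "0 < 2 - c\<^sub>1 - c\<^sub>2" by simp
  have \<eta>0: "0 \<le> \<eta>" using c d by (simp add: assms(14))
  \<comment> \<open>This product is \<open>c\<^sub>2 (2 - c\<^sub>1 - c\<^sub>2) - (c\<^sub>2 - c\<^sub>1)\<close>.\<close>
  have "0 \<le> (1 - c\<^sub>2) * (c\<^sub>1 + c\<^sub>2)" using c by (intro mult_nonneg_nonneg) auto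
  then have "c\<^sub>2 - c\<^sub>1 \<le> c\<^sub>2 * (2 - c\<^sub>1 - c\<^sub>2)" by (simp add: algebra_simps)
  then have "\<eta> \<le> c\<^sub>2" using d by (simp add: assms(14) pos_divide_le_eq)
  then have \<eta>_le: "\<eta> \<le> \<gamma>\<^sup>2" using c by simp

  have rate: "\<eta> ^ k * cT \<le> \<gamma> ^ (2 * (k + 1))" for k :: nat
  proof -
    have "\<eta> ^ k * cT \<le> (\<gamma>\<^sup>2) ^ k * \<gamma>\<^sup>2"
      using \<eta>0 \<eta>_le cT0 cT_le by (intro mult_mono power_mono) auto
    then show ?thesis by (simp only: power_mult power_add power_one_right)
  qed

  define \<alpha> where "\<alpha> = 2 / (2 - c\<^sub>1 - c\<^sub>2)"
  define F where "F = (\<lambda>x. x + \<alpha> *\<^sub>R (T x - x))"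
  have id: "id \<in> Psi U m" by (auto simp: Psi_def refl_comp_def intro!: exI[of _ "[]"])
  have S: "finite S" "S \<noteq> {}" using assms(6,7) id by auto
  have iso: "norm (G x - z) = norm (x - z)" if "G \<in> S" "z \<in> M" for G x z
  proof -
    from that(1) assms(8) obtain js where "set js \<subseteq> {1..m}" "G = refl_comp U js"
      by (auto simp: Omega_def)
    moreover from this that(2) have "z \<in> (\<Inter>i\<in>set js. U i)" unfolding M_eq[symmetric] by blast
    ultimately show ?thesis using norm_refl_comp_diff[where I = "{1..m}", of U] U by blast
  qed
  have F_aff: "F x \<in> affine hull ((\<lambda>G. G x) ` S)" for x
  proof -
    have "T x \<in> affine hull ((\<lambda>G. G x) ` S)"
      unfolding assms(9)
      by (rule subsetD[OF hull_mono[OF image_mono[OF assms(7)]]])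
         (use proj_comp_in_affine_hull_Psi U in blast)
    moreover have "x \<in> affine hull ((\<lambda>G. G x) ` S)"
      using id assms(7) by (intro hull_inc image_eqI[of _ _ id]) auto
    ultimately have "(1 - \<alpha>) *\<^sub>R x + \<alpha> *\<^sub>R T x \<in> affine hull ((\<lambda>G. G x) ` S)"
      by (intro mem_affine affine_affine_hull) auto
    then show ?thesis by (simp add: F_def algebra_simps)
  qed
  have T_diff: "T (x - proj M x) = T x - proj M x" for x
    by (simp add: linear_diff[OF T_linear] T_fixes proj_in[OF M])
  have F_le: "norm (F x - proj M x) \<le> \<eta> * norm (x - proj M x)" for x
  proof -
    have F_diff: "F x - proj M x = (x - proj M x) + \<alpha> *\<^sub>R (T (x - proj M x) - (x - proj M x))"
      by (simp add: F_def T_diff)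
    have c12: "c\<^sub>1 + c\<^sub>2 < 2" using d by simp
    show ?thesis
      unfolding F_diff \<alpha>_def assms(14)
      by (rule relaxation_norm_le[OF V T_linear T_V sa lower upper c12 in_V])
  qed
  have "norm ((CC S ^^ k) (T x) - proj M x) \<le> \<eta> ^ k * cT * norm (x - proj M x)" for x k
  proof -
    have "T x - proj M x \<in> V" using T_V[OF in_V[of x]] by (simp add: T_diff)
    then have "inner (T x - proj M x) z = 0" if "z \<in> M" for z
      using that by (simp add: V_def orthogonal_comp_def orthogonal_def inner_commute[of _ z])
    then have PT: "proj M (T x) = proj M x" by (rule proj_unique[OF M(1) proj_in[OF M]])
    have "norm ((CC S ^^ k) (T x) - proj M (T x)) \<le> \<eta> ^ k * norm (T x - proj M (T x))"
      by (rule norm_CC_funpow_le[OF S M, where F = F]) (fact iso F_aff \<eta>0 F_le)+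
    also have "\<dots> \<le> \<eta> ^ k * (cT * norm (x - proj M x))"
    proof (intro mult_left_mono zero_le_power \<eta>0)
      show "norm (T x - proj M (T x)) \<le> cT * norm (x - proj M x)"
        using onorm[OF bl(2), of "x - proj M x"]
        by (simp only: PT cT proj_V_id[OF in_V] T_diff)
    qed
    finally show ?thesis by (simp add: PT mult.assoc)
  qed
  with rate show ?thesis unfolding M_def by blast
qed

end
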